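(* Let $c\in(0,1)$ be the universal constant with property (P) described in the context. Let $n\geq 8$, let $M$ be an $n\times n$ jointly exchangeable random matrix with zero diagonal, and let $T$ be the $\lfloor n/2\rfloor\times\lfloor n/2\rfloor$ top right corner of $M$. Then $$\mathbb{P}\{\|M\|\geq \tau\}\leq c^{-1}\,\mathbb{P}\{\|T\|\geq c\,\tau\}\qquad\text{for all }\tau>0.$$
   Context: Matrices have real entries. For an $n\times n$ matrix $M=(M_{ij})$ and a permutation $\sigma$ of $\{1,\dots,n\}$, $\sigma(M)$ denotes the matrix $(M_{\sigma(i)\sigma(j)})_{i,j=1}^n$. A random $n\times n$ matrix $M$ is jointly exchangeable if $M$ is equidistributed with $\sigma(M)$ for every non-random permutation $\sigma$. $\|\cdot\|$ is the spectral norm. The $\lfloor n/2\rfloor\times\lfloor n/2\rfloor$ top right corner of an $n\times n$ matrix is the submatrix formed by rows $1,\dots,\lfloor n/2\rfloor$ and columns $n-\lfloor n/2\rfloor+1,\dots,n$. Property (P) of a constant $c\in(0,1)$: for every $n\ge 8$, every random $n\times n$ matrix $M'$ with zero diagonal, every uniform random permutation $\sigma$ of $\{1,\dots,n\}$ independent of $M'$, and every event $\mathcal{E}$ with $\mathbb{P}(\mathcal{E}\mid M')\geq 1-c$ everywhere on the probability space, denoting by $T'$ the $\lfloor n/2\rfloor\times\lfloor n/2\rfloor$ top right corner of $\sigma(M')$, one has $\mathbb{P}\{\|M'\|\geq \tau\}\leq \frac1c\,\mathbb{P}\{\|T'\|\geq c\tau\text{ and }\mathcal{E}\text{ holds}\}$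 for all $\tau>0$. The paper establishes that a universal constant with property (P) exists and fixes such a constant $c$. *)

theory Defs
  imports "HOL-Probability.Probability"
begin

text \<open>
  An \<open>n \<times> n\<close> matrix is an extensional function on index pairs from \<open>{1..n}\<close>; a random matrix is a
  measurable map into \<open>matrix_space n\<close>.
\<close>

type_synonym matrix = "nat \<times> nat \<Rightarrow> real"

definition matrix_space :: "nat \<Rightarrow> matrix measure" where
  "matrix_space n = (\<Pi>\<^sub>M _\<in>{1..n} \<times> {1..n}. borel)"

definition random_matrix :: "nat \<Rightarrow> 'w measure \<Rightarrow> ('w \<Rightarrow> matrix) \<Rightarrow> bool" where
  "random_matrix n \<Omega> M \<longleftrightarrow> M \<in> measurable \<Omega> (matrix_space n)"

definition zero_diagonal :: "nat \<Rightarrow> 'w measure \<Rightarrow> ('w \<Rightarrow> matrix) \<Rightarrow> bool" where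
  "zero_diagonal n \<Omega> M \<longleftrightarrow> (\<forall>\<omega>\<in>space \<Omega>. \<forall>i\<in>{1..n}. M \<omega> (i, i) = 0)"

definition permute_matrix :: "nat \<Rightarrow> (nat \<Rightarrow> nat) \<Rightarrow> matrix \<Rightarrow> matrix" where
  "permute_matrix n \<sigma> A = (\<lambda>(i, j)\<in>{1..n} \<times> {1..n}. A (\<sigma> i, \<sigma> j))"

definition jointly_exchangeable :: "nat \<Rightarrow> 'w measure \<Rightarrow> ('w \<Rightarrow> matrix) \<Rightarrow> bool" where
  "jointly_exchangeable n \<Omega> M \<longleftrightarrow> random_matrix n \<Omega> M \<and>
     (\<forall>\<pi>. \<pi> permutes {1..n} \<longrightarrow>
        distr \<Omega> (matrix_space n) M =
        distr \<Omega> (matrix_space n) (\<lambda>\<omega>. permute_matrix n \<pi> (M \<omega>)))"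

definition top_right_corner :: "nat \<Rightarrow> matrix \<Rightarrow> matrix" where
  "top_right_corner n A =
     (\<lambda>(i, j)\<in>{1..n div 2} \<times> {1..n div 2}. A (i, n - n div 2 + j))"

text \<open>The Euclidean operator norm of an \<open>n \<times> n\<close> matrix.\<close>

definition spectral_norm :: "nat \<Rightarrow> matrix \<Rightarrow> real" where
  "spectral_norm n A =
     (SUP x\<in>{x. L2_set x {1..n} \<le> 1}. L2_set (\<lambda>i. \<Sum>j\<in>{1..n}. A (i, j) * x j) {1..n})"

definition perms :: "nat \<Rightarrow> (nat \<Rightarrow> nat) set" where
  "perms n = {\<pi>. \<pi> permutes {1..n}}"

definition uniform_random_permutation :: "nat \<Rightarrow> 'w measure \<Rightarrow> ('w \<Rightarrow> nat \<Rightarrow> nat) \<Rightarrow> bool" where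
  "uniform_random_permutation n \<Omega> \<sigma> \<longleftrightarrow>
     \<sigma> \<in> measurable \<Omega> (count_space (perms n)) \<and>
     distr \<Omega> (count_space (perms n)) \<sigma> = uniform_count_measure (perms n)"

text \<open>
  The sigma-algebra generated by a map. Independence is stated through it because \<open>indep_var\<close>
  requires both variables to take values in the same type.
\<close>

abbreviation generated :: "'w measure \<Rightarrow> ('w \<Rightarrow> 'b) \<Rightarrow> 'b measure \<Rightarrow> 'w measure" where
  "generated \<Omega> X N \<equiv> vimage_algebra (space \<Omega>) X N"

text \<open>
  \<open>real_cond_exp\<close> picks an arbitrary version of a conditional expectation. A bound
  \<open>P(E | F) \<ge> p\<close> that holds everywhere is a statement about some version \<open>q\<close>.
\<close>

definition cond_prob_ge :: "'w measure \<Rightarrow> 'w measure \<Rightarrow> 'w set \<Rightarrow> real \<Rightarrow> bool" where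
  "cond_prob_ge \<Omega> F E p \<longleftrightarrow>
     (\<exists>q\<in>borel_measurable F.
        (AE \<omega> in \<Omega>. q \<omega> = real_cond_exp \<Omega> F (indicator E) \<omega>) \<and>
        (\<forall>\<omega>\<in>space \<Omega>. q \<omega> \<ge> p))"

text \<open>
  A formula cannot quantify over all types of sample points. Both the hypotheses and the conclusion
  of the property below depend only on the joint law of \<open>M'\<close>, \<open>\<sigma>\<close> and the indicator of \<open>E\<close>, and
  each such law is realised by the coordinate maps on the following type. So letting \<open>\<Omega>\<close> range over
  all probability spaces on this type loses no generality.
\<close>

type_synonym sample_point = "matrix \<times> (nat \<Rightarrow> nat) \<times> bool"

definition property_P :: "real \<Rightarrow> bool" where
  "property_P c \<longleftrightarrow>
     (\<forall>n\<ge>8. \<forall>(\<Omega> :: sample_point measure) M' \<sigma> E.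
        prob_space \<Omega> \<longrightarrow>
        random_matrix n \<Omega> M' \<longrightarrow>
        zero_diagonal n \<Omega> M' \<longrightarrow>
        uniform_random_permutation n \<Omega> \<sigma> \<longrightarrow>
        prob_space.indep_set \<Omega>
          (sets (generated \<Omega> M' (matrix_space n)))
          (sets (generated \<Omega> \<sigma> (count_space (perms n)))) \<longrightarrow>
        E \<in> sets \<Omega> \<longrightarrow>
        cond_prob_ge \<Omega> (generated \<Omega> M' (matrix_space n)) E (1 - c) \<longrightarrow>
        (\<forall>\<tau>>0.
           measure \<Omega> {\<omega> \<in> space \<Omega>. spectral_norm n (M' \<omega>) \<ge> \<tau>}
           \<le> 1 / c * measure \<Omega> {\<omega> \<in> space \<Omega>.
               spectral_norm (n div 2) (top_right_corner n (permute_matrix n (\<sigma> \<omega>) (M' \<omega>)))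
                 \<ge> c * \<tau> \<and> \<omega> \<in> E}))"

end

theory Submission
  imports Defs
begin

text \<open>
  Relabelling the rows and columns of a jointly exchangeable matrix by a permutation that is
  independent of it does not change its law. So the corollary is property (P) applied to the
  coordinates of the product of the law of \<open>M\<close> with the uniform measure on permutations, with the
  sure event as \<open>E\<close>: by Fubini, the probability on the right of (P) is an average over \<open>\<pi>\<close> of the
  probabilities of \<open>\<parallel>T\<^sub>\<pi>\<parallel> \<ge> c \<tau>\<close>, where \<open>T\<^sub>\<pi>\<close> is the corner of \<open>\<pi>(M)\<close>, and all of them agree with
  the one for the identity.

  Two points need care. The probabilities only transfer between the two sample spaces if the
  spectral norm is Borel measurable, although it is a supremum over an uncountable set of vectors;
  this is \<open>spectral_norm_measurable\<close>, obtained from the fact that rational vectors suffice. And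
  (P) asks for a zero diagonal at every sample point, whereas under the law of \<open>M\<close> this is only
  almost sure; so the matrix fed into (P) is the first coordinate with its diagonal cleared, which
  has the same law.
\<close>

section \<open>Measurability of the spectral norm\<close>

lemma bdd_above_matrix_image:
  "bdd_above ((\<lambda>x. L2_set (\<lambda>i. \<Sum>j\<in>{1..n}. A (i, j) * x j) {1..n})
     ` {x :: nat \<Rightarrow> real. L2_set x {1..n} \<le> 1})"
proof (rule bdd_aboveI2)
  fix x :: "nat \<Rightarrow> real"
  assume "x \<in> {x. L2_set x {1..n} \<le> 1}"
  hence le1: "L2_set x {1..n} \<le> 1" by simp
  have x: "\<bar>x j\<bar> \<le> 1" if "j \<in> {1..n}" for j
  proof -
    have "\<bar>x j\<bar> \<le> L2_set (\<lambda>j. \<bar>x j\<bar>) {1..n}"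
      using that by (intro member_le_L2_set) auto
    also have "\<dots> = L2_set x {1..n}" by (simp add: L2_set_def)
    finally show ?thesis using le1 by linarith
  qed
  have "L2_set (\<lambda>i. \<Sum>j\<in>{1..n}. A (i, j) * x j) {1..n}
          \<le> (\<Sum>i\<in>{1..n}. \<bar>\<Sum>j\<in>{1..n}. A (i, j) * x j\<bar>)"
    by (rule L2_set_le_sum_abs)
  also have "\<dots> \<le> (\<Sum>i\<in>{1..n}. \<Sum>j\<in>{1..n}. \<bar>A (i, j) * x j\<bar>)"
    by (intro sum_mono sum_abs)
  also have "\<dots> \<le> (\<Sum>i\<in>{1..n}. \<Sum>j\<in>{1..n}. \<bar>A (i, j)\<bar>)"
    by (intro sum_mono) (simp only: abs_mult mult_left_le x abs_ge_zero)
  finally show "L2_set (\<lambda>i. \<Sum>j\<in>{1..n}. A (i, j) * x j) {1..n}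
                  \<le> (\<Sum>i\<in>{1..n}. \<Sum>j\<in>{1..n}. \<bar>A (i, j)\<bar>)" .
qed

lemma spectral_norm_nonneg: "0 \<le> spectral_norm n A"
proof -
  have "L2_set (\<lambda>i. \<Sum>j\<in>{1..n}. A (i, j) * (\<lambda>_. 0) j) {1..n} \<le> spectral_norm n A"
    unfolding spectral_norm_def
    by (rule cSUP_upper[OF _ bdd_above_matrix_image]) (simp add: L2_set_def)
  thus ?thesis by (simp add: L2_set_def)
qed

text \<open>
  By homogeneity the constraint \<open>\<parallel>x\<parallel> \<le> 1\<close> in the supremum can be dropped. The resulting
  inequality is closed in \<open>x\<close>, so it can be tested on a dense set of vectors, without
  approximating inside the unit ball.
\<close>

lemma spectral_norm_le_iff:
  assumes "0 \<le> t"
  shows "spectral_norm n A \<le> t \<longleftrightarrow>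
           (\<forall>x. L2_set (\<lambda>i. \<Sum>j\<in>{1..n}. A (i, j) * x j) {1..n} \<le> t * L2_set x {1..n})"
    (is "_ \<longleftrightarrow> (\<forall>x. ?N x \<le> _)")
proof -
  have "(\<lambda>_. 0) \<in> {x. L2_set x {1..n} \<le> (1 :: real)}"
    by (simp add: L2_set_def)
  hence "{x. L2_set x {1..n} \<le> (1 :: real)} \<noteq> {}" by blast
  hence "spectral_norm n A \<le> t \<longleftrightarrow> (\<forall>x. L2_set x {1..n} \<le> 1 \<longrightarrow> ?N x \<le> t)"
    unfolding spectral_norm_def by (subst cSUP_le_iff[OF _ bdd_above_matrix_image]) blast+
  also have "\<dots> \<longleftrightarrow> (\<forall>x. ?N x \<le> t * L2_set x {1..n})"
  proof (intro iffI allI impI)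
    fix x
    assume *: "\<forall>x. L2_set x {1..n} \<le> 1 \<longrightarrow> ?N x \<le> t"
    show "?N x \<le> t * L2_set x {1..n}"
    proof (cases "L2_set x {1..n} = 0")
      case True
      hence "?N x = 0" by (simp add: L2_set_eq_0_iff)
      thus ?thesis using True by simp
    next
      case False
      define r where "r = L2_set x {1..n}"
      have r: "0 < r" using False L2_set_nonneg[of x "{1..n}"] unfolding r_def by linarith
      have scale: "L2_set (\<lambda>i. inverse r * y i) {1..n} = inverse r * L2_set y {1..n}" for y
        using r by (simp add: L2_set_right_distrib)
      have hom: "?N (\<lambda>j. inverse r * x j) = inverse r * ?N x"
        unfolding scale[symmetric] sum_distrib_left by (simp only: mult.left_commute)
      have unit: "L2_set (\<lambda>j. inverse r * x j) {1..n} \<le> 1"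
        unfolding scale r_def[symmetric] using r by simp
      have "inverse r * ?N x \<le> t"
        unfolding hom[symmetric] by (rule *[rule_format, OF unit])
      thus ?thesis using r unfolding r_def[symmetric] by (simp add: field_simps)
    qed
  next
    fix x
    assume "\<forall>x. ?N x \<le> t * L2_set x {1..n}" and "L2_set x {1..n} \<le> 1"
    thus "?N x \<le> t" using mult_left_le[OF _ assms] order_trans by blast
  qed
  finally show ?thesis .
qed

text \<open>
  A fixed countable family of test vectors makes the sublevel sets of the norm countable
  intersections of measurable sets.
\<close>

lemma spectral_norm_le_iff_rational:
  assumes "0 \<le> t"
  shows "spectral_norm n A \<le> t \<longleftrightarrow>
           (\<forall>x\<in>{1..n} \<rightarrow>\<^sub>E \<rat>.
              L2_set (\<lambda>i. \<Sum>j\<in>{1..n}. A (i, j) * x j) {1..n} \<le> t * L2_set x {1..n})"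
    (is "_ \<longleftrightarrow> (\<forall>x\<in>?Q. ?N x \<le> _)")
proof
  assume "spectral_norm n A \<le> t"
  thus "\<forall>x\<in>?Q. ?N x \<le> t * L2_set x {1..n}" using spectral_norm_le_iff[OF assms] by blast
next
  assume *: "\<forall>x\<in>?Q. ?N x \<le> t * L2_set x {1..n}"
  show "spectral_norm n A \<le> t"
    unfolding spectral_norm_le_iff[OF assms]
  proof
    fix x :: "nat \<Rightarrow> real"
    have "\<exists>q. (\<forall>k. q k \<in> \<rat>) \<and> q \<longlonglongrightarrow> x j" for j
    proof -
      have "x j \<in> closure \<rat>" by (simp add: Rats_closure_real)
      thus ?thesis unfolding closure_sequential .
    qed
    then obtain q where q: "\<And>j k. q j k \<in> \<rat>" "\<And>j. q j \<longlonglongrightarrow> x j" by metis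
    define y where "y k = (\<lambda>j\<in>{1..n}. q j k)" for k
    have y: "(\<lambda>k. y k j) \<longlonglongrightarrow> x j" if "j \<in> {1..n}" for j
      using q(2)[of j] that by (simp add: y_def)
    have "(\<lambda>k. ?N (y k)) \<longlonglongrightarrow> ?N x"
      unfolding L2_set_def by (intro tendsto_intros y)
    moreover have "(\<lambda>k. t * L2_set (y k) {1..n}) \<longlonglongrightarrow> t * L2_set x {1..n}"
      unfolding L2_set_def by (intro tendsto_intros y)
    moreover have "y k \<in> ?Q" for k
      using q(1) by (simp add: y_def)
    ultimately show "?N x \<le> t * L2_set x {1..n}"
      using * by (intro LIMSEQ_le[of "\<lambda>k. ?N (y k)"]) auto
  qed
qed

lemma entry_measurable:
  assumes "i \<in> {1..n}" "j \<in> {1..n}"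
  shows "(\<lambda>A. A (i, j)) \<in> borel_measurable (matrix_space n)"
  unfolding matrix_space_def using assms by (intro measurable_component_singleton) auto

lemma spectral_norm_measurable: "spectral_norm n \<in> borel_measurable (matrix_space n)"
proof (rule borel_measurableI_le)
  fix t
  show "{A \<in> space (matrix_space n). spectral_norm n A \<le> t} \<in> sets (matrix_space n)"
  proof (cases "0 \<le> t")
    case True
    have "countable ({1..n} \<rightarrow>\<^sub>E (\<rat> :: real set))"
      by (intro countable_PiE countable_rat) auto
    moreover have "(\<lambda>A. L2_set (\<lambda>i. \<Sum>j\<in>{1..n}. A (i, j) * x j) {1..n})
                     \<in> borel_measurable (matrix_space n)" for x
      unfolding L2_set_def
      by (intro borel_measurable_sqrt[THEN measurable_compose[rotated]] borel_measurable_sum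
            borel_measurable_power borel_measurable_times entry_measurable) auto
    ultimately show ?thesis
      unfolding spectral_norm_le_iff_rational[OF True]
      by (intro sets.sets_Collect_countable_All' borel_measurable_le) auto
  next
    case False
    hence "{A \<in> space (matrix_space n). spectral_norm n A \<le> t} = {}"
      using spectral_norm_nonneg order_trans by blast
    thus ?thesis by (simp only: sets.empty_sets)
  qed
qed

section \<open>Submatrices, permutations and the diagonal\<close>

lemma reindexing_measurable:
  assumes "\<And>i j. i \<in> {1..m} \<Longrightarrow> j \<in> {1..m} \<Longrightarrow> r i \<in> {1..n} \<and> s j \<in> {1..n}"
  shows "(\<lambda>A. \<lambda>(i, j)\<in>{1..m} \<times> {1..m}. A (r i, s j)) \<in> measurable (matrix_space n) (matrix_space m)"
  unfolding matrix_space_def[of m]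
proof (rule measurable_restrict)
  fix p assume "p \<in> {1..m} \<times> {1..m}"
  thus "(\<lambda>A. case p of (i, j) \<Rightarrow> A (r i, s j)) \<in> borel_measurable (matrix_space n)"
    using assms by (auto intro!: entry_measurable simp del: atLeastAtMost_iff)
qed

lemma permute_matrix_measurable:
  assumes "\<pi> permutes {1..n}"
  shows "permute_matrix n \<pi> \<in> measurable (matrix_space n) (matrix_space n)"
  unfolding permute_matrix_def
  using permutes_in_image[OF assms] by (intro reindexing_measurable) blast

lemma top_right_corner_measurable:
  "top_right_corner n \<in> measurable (matrix_space n) (matrix_space (n div 2))"
  unfolding top_right_corner_def by (intro reindexing_measurable) auto

definition clear_diagonal :: "nat \<Rightarrow> matrix \<Rightarrow> matrix" where
  "clear_diagonal n A = (\<lambda>(i, j)\<in>{1..n} \<times> {1..n}. if i = j then 0 else A (i, j))"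

lemma clear_diagonal_measurable:
  "clear_diagonal n \<in> measurable (matrix_space n) (matrix_space n)"
  unfolding clear_diagonal_def matrix_space_def[of n]
proof (rule measurable_restrict)
  fix p assume "p \<in> {1..n} \<times> {1..n}"
  thus "(\<lambda>A. case p of (i, j) \<Rightarrow> if i = j then 0 else A (i, j))
          \<in> borel_measurable (\<Pi>\<^sub>M _\<in>{1..n} \<times> {1..n}. borel)"
    using entry_measurable[of _ n] unfolding matrix_space_def by (cases p) auto
qed

lemma clear_diagonal_eq:
  assumes "A \<in> space (matrix_space n)" "\<And>i. i \<in> {1..n} \<Longrightarrow> A (i, i) = 0"
  shows "clear_diagonal n A = A"
proof
  fix p
  show "clear_diagonal n A p = A p"
    using assms
    by (cases p) (auto simp: clear_diagonal_def matrix_space_def space_PiM PiE_def extensional_def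
                       simp del: atLeastAtMost_iff)
qed

lemma jointly_exchangeable_emeasure_eq:
  assumes "jointly_exchangeable n \<Omega> M" "\<pi> permutes {1..n}" "S \<in> sets (matrix_space n)"
  shows "emeasure \<Omega> {\<omega> \<in> space \<Omega>. permute_matrix n \<pi> (M \<omega>) \<in> S}
           = emeasure \<Omega> {\<omega> \<in> space \<Omega>. M \<omega> \<in> S}"
proof -
  have M: "M \<in> measurable \<Omega> (matrix_space n)"
    and eq: "distr \<Omega> (matrix_space n) M
               = distr \<Omega> (matrix_space n) (\<lambda>\<omega>. permute_matrix n \<pi> (M \<omega>))"
    using assms unfolding jointly_exchangeable_def random_matrix_def by auto
  have "emeasure (distr \<Omega> (matrix_space n) M) S = emeasure \<Omega> {\<omega> \<in> space \<Omega>. M \<omega> \<in> S}"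
    using M assms(3) by (simp add: emeasure_distr vimage_def Int_def conj_commute)
  moreover have "emeasure (distr \<Omega> (matrix_space n) M) S
                   = emeasure \<Omega> {\<omega> \<in> space \<Omega>. permute_matrix n \<pi> (M \<omega>) \<in> S}"
    unfolding eq
    using measurable_compose[OF M permute_matrix_measurable[OF assms(2)]] assms(3)
    by (simp add: emeasure_distr vimage_def Int_def conj_commute)
  ultimately show ?thesis by simp
qed

section \<open>Product spaces and the sure event\<close>

lemma sets_generated_subset:
  assumes "X \<in> measurable \<Omega> N"
  shows "sets (generated \<Omega> X N) \<subseteq> sets \<Omega>"
proof -
  have "X \<in> space \<Omega> \<rightarrow> space N" using assms by (rule measurable_space[THEN funcsetI])
  thus ?thesis using assms by (auto simp: sets_vimage_algebra2 intro: measurable_sets)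
qed

lemma distr_snd_prob:
  assumes "prob_space P" "sigma_finite_measure Q"
  shows "distr (P \<Otimes>\<^sub>M Q) Q snd = Q"
proof (rule measure_eqI)
  interpret P: prob_space P by fact
  interpret Q: sigma_finite_measure Q by fact
  fix A assume "A \<in> sets (distr (P \<Otimes>\<^sub>M Q) Q snd)"
  hence A: "A \<in> sets Q" by simp
  have "snd -` A \<inter> space (P \<Otimes>\<^sub>M Q) = space P \<times> A"
    using sets.sets_into_space[OF A] by (auto simp: space_pair_measure)
  thus "emeasure (distr (P \<Otimes>\<^sub>M Q) Q snd) A = emeasure Q A"
    using A by (simp add: emeasure_distr Q.emeasure_pair_measure_Times P.emeasure_space_1)
qed simp

lemma indep_set_product_coordinates:
  assumes "prob_space P" "prob_space Q"
    and X: "X \<in> measurable P N" and Y: "Y \<in> measurable Q K"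
  shows "prob_space.indep_set (P \<Otimes>\<^sub>M Q)
           (sets (generated (P \<Otimes>\<^sub>M Q) (\<lambda>\<omega>. X (fst \<omega>)) N))
           (sets (generated (P \<Otimes>\<^sub>M Q) (\<lambda>\<omega>. Y (snd \<omega>)) K))"
proof -
  interpret P: prob_space P by fact
  interpret Q: prob_space Q by fact
  interpret PQ: pair_prob_space P Q ..
  let ?S = "P \<Otimes>\<^sub>M Q"
  have X': "(\<lambda>\<omega>. X (fst \<omega>)) \<in> measurable ?S N" and Y': "(\<lambda>\<omega>. Y (snd \<omega>)) \<in> measurable ?S K"
    using X Y by measurable
  show ?thesis
  proof (rule PQ.indep_setI)
    show "sets (generated ?S (\<lambda>\<omega>. X (fst \<omega>)) N) \<subseteq> PQ.events"
      and "sets (generated ?S (\<lambda>\<omega>. Y (snd \<omega>)) K) \<subseteq> PQ.events"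
      using X' Y' by (simp_all only: sets_generated_subset)
  next
    fix a b
    assume "a \<in> sets (generated ?S (\<lambda>\<omega>. X (fst \<omega>)) N)"
      and "b \<in> sets (generated ?S (\<lambda>\<omega>. Y (snd \<omega>)) K)"
    moreover have "(\<lambda>\<omega>. X (fst \<omega>)) \<in> space ?S \<rightarrow> space N" "(\<lambda>\<omega>. Y (snd \<omega>)) \<in> space ?S \<rightarrow> space K"
      using X' Y' by (auto dest: measurable_space)
    ultimately obtain A B where A: "A \<in> sets N" "a = (\<lambda>\<omega>. X (fst \<omega>)) -` A \<inter> space ?S"
      and B: "B \<in> sets K" "b = (\<lambda>\<omega>. Y (snd \<omega>)) -` B \<inter> space ?S"
      by (auto simp: sets_vimage_algebra2)
    define A' B' where "A' = X -` A \<inter> space P" and "B' = Y -` B \<inter> space Q"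
    have [simp]: "A' \<in> sets P" "B' \<in> sets Q"
      using A B X Y by (auto simp: A'_def B'_def intro: measurable_sets)
    have "a = A' \<times> space Q" "b = space P \<times> B'" "a \<inter> b = A' \<times> B'"
      by (auto simp: A B A'_def B'_def space_pair_measure)
    thus "PQ.prob (a \<inter> b) = PQ.prob a * PQ.prob b"
      by (simp add: measure_def Q.emeasure_pair_measure_Times enn2real_mult
            P.emeasure_space_1 Q.emeasure_space_1)
  qed
qed

lemma cond_prob_ge_space:
  assumes "prob_space \<Omega>" "subalgebra \<Omega> F" "p \<le> 1"
  shows "cond_prob_ge \<Omega> F (space \<Omega>) p"
proof -
  interpret prob_space \<Omega> by fact
  interpret F: finite_measure_subalgebra \<Omega> F
    by unfold_locales fact
  have sp: "space F = space \<Omega>" using assms(2) by (simp add: subalgebra_def)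
  have "indicator (space \<Omega>) \<in> borel_measurable F" unfolding sp[symmetric] by simp
  moreover have "integrable \<Omega> (indicator (space \<Omega>) :: _ \<Rightarrow> real)"
    by (rule integrable_real_indicator) (simp_all add: emeasure_space_1)
  ultimately
  have "AE \<omega> in \<Omega>. real_cond_exp \<Omega> F (indicator (space \<Omega>)) \<omega> = indicator (space \<Omega>) \<omega>"
    by (rule F.real_cond_exp_F_meas[rotated])
  hence "AE \<omega> in \<Omega>. 1 = real_cond_exp \<Omega> F (indicator (space \<Omega>)) \<omega>"
    using AE_space by eventually_elim simp
  thus ?thesis unfolding cond_prob_ge_def using assms(3) by (intro bexI[of _ "\<lambda>_. 1"]) auto
qed

section \<open>The comparison for exchangeable matrices\<close>

theorem corollary1p2:
  fixes c :: real and n :: nat and \<Omega> :: "'a measure" and M :: "'a \<Rightarrow> matrix"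
  assumes "0 < c" and "c < 1" and "property_P c"
    and "n \<ge> 8"
    and "prob_space \<Omega>"
    and "jointly_exchangeable n \<Omega> M"
    and "zero_diagonal n \<Omega> M"
  shows "\<forall>\<tau>>0.
    measure \<Omega> {\<omega> \<in> space \<Omega>. spectral_norm n (M \<omega>) \<ge> \<tau>}
    \<le> 1 / c * measure \<Omega> {\<omega> \<in> space \<Omega>.
        spectral_norm (n div 2) (top_right_corner n (M \<omega>)) \<ge> c * \<tau>}"
proof (intro allI impI)
  fix \<tau> :: real
  assume \<tau>: "0 < \<tau>"
  interpret \<Omega>: prob_space \<Omega> by fact
  let ?N = "matrix_space n"
  have M: "M \<in> measurable \<Omega> ?N"
    using assms(6) unfolding jointly_exchangeable_def random_matrix_def by simp
  have diag: "clear_diagonal n (M \<omega>) = M \<omega>" if "\<omega> \<in> space \<Omega>" for \<omega>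
    using that measurable_space[OF M] assms(7) unfolding zero_diagonal_def
    by (intro clear_diagonal_eq) auto
  have fin: "finite (perms n)" unfolding perms_def by (rule finite_permutations) simp
  have ne: "perms n \<noteq> {}" unfolding perms_def using permutes_id by blast

  define L where "L = distr \<Omega> ?N M"
  define U where "U = uniform_count_measure (perms n)"
  \<comment> \<open>The boolean factor is there only because \<open>sample_point\<close> has such a component.\<close>
  define V where "V = U \<Otimes>\<^sub>M return (count_space UNIV) True"
  define W where "W = L \<Otimes>\<^sub>M V"
  define M' where "M' = (\<lambda>\<omega> :: sample_point. clear_diagonal n (fst \<omega>))"
  define \<sigma> where "\<sigma> = (\<lambda>\<omega> :: sample_point. fst (snd \<omega>))"
  define Bad where "Bad = {A \<in> space ?N. spectral_norm n A \<ge> \<tau>}"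
  define Good where "Good = {A \<in> space ?N. spectral_norm (n div 2) (top_right_corner n A) \<ge> c * \<tau>}"

  have Bad: "Bad \<in> sets ?N"
    unfolding Bad_def by (intro borel_measurable_le spectral_norm_measurable) simp
  have Good: "Good \<in> sets ?N"
    unfolding Good_def
    by (intro borel_measurable_le measurable_compose[OF top_right_corner_measurable
          spectral_norm_measurable]) simp

  interpret L: prob_space L unfolding L_def using M by (rule \<Omega>.prob_space_distr)
  interpret U: prob_space U unfolding U_def by (rule prob_space_uniform_count_measure[OF fin ne])
  interpret B: prob_space "return (count_space UNIV) True" by (rule prob_space_return) simp
  interpret UB: pair_prob_space U "return (count_space UNIV) True" ..
  interpret V: prob_space V unfolding V_def by (rule UB.prob_space_axioms)
  interpret LV: pair_prob_space L V ..
  interpret W: prob_space W unfolding W_def by (rule LV.prob_space_axioms)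

  have setsL: "sets L = sets ?N" and spaceL: "space L = space ?N" by (simp_all add: L_def)
  have setsU: "sets U = sets (count_space (perms n))"
    by (simp add: U_def sets_uniform_count_measure)
  have meas_L: "clear_diagonal n \<in> measurable L ?N"
    using clear_diagonal_measurable by (simp add: measurable_cong_sets[OF setsL refl])
  have meas_fst: "fst \<in> measurable V (count_space (perms n))"
    unfolding V_def using measurable_fst by (simp add: measurable_cong_sets[OF refl setsU[symmetric]])
  have M': "M' \<in> measurable W ?N"
    unfolding M'_def W_def by (rule measurable_compose[OF measurable_fst meas_L])
  have \<sigma>: "\<sigma> \<in> measurable W (count_space (perms n))"
    unfolding \<sigma>_def W_def by (rule measurable_compose[OF measurable_snd meas_fst])
  have \<sigma>M': "(\<lambda>\<omega>. permute_matrix n (\<sigma> \<omega>) (M' \<omega>)) \<in> measurable W ?N"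
    by (rule measurable_compose_countable'[OF _ \<sigma>])
       (use fin in \<open>auto simp: perms_def countable_finite
          intro: measurable_compose[OF M' permute_matrix_measurable]\<close>)

  have "distr W (count_space (perms n)) \<sigma> = distr (distr W V snd) (count_space (perms n)) fst"
    unfolding W_def \<sigma>_def by (subst distr_distr[OF meas_fst]) (auto simp: comp_def)
  also have "\<dots> = distr V U fst"
    unfolding W_def
    by (subst distr_snd_prob)
       (auto intro: distr_cong simp: setsU L.prob_space_axioms V.sigma_finite_measure_axioms)
  also have "\<dots> = U"
    unfolding V_def by (rule B.distr_pair_fst)
  finally have unif: "uniform_random_permutation n W \<sigma>"
    unfolding uniform_random_permutation_def using \<sigma> by (simp add: U_def)

  have indep: "W.indep_set (sets (generated W M' ?N)) (sets (generated W \<sigma> (count_space (perms n))))"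
    unfolding W_def M'_def \<sigma>_def
    by (rule indep_set_product_coordinates[OF L.prob_space_axioms V.prob_space_axioms meas_L meas_fst])

  have "subalgebra W (generated W M' ?N)"
    unfolding subalgebra_def using sets_generated_subset[OF M'] by simp
  hence cond: "cond_prob_ge W (generated W M' ?N) (space W) (1 - c)"
    using assms(1) W.prob_space_axioms by (intro cond_prob_ge_space) auto

  have zero: "zero_diagonal n W M'"
    by (auto simp: zero_diagonal_def M'_def clear_diagonal_def)

  have "measure W {\<omega> \<in> space W. spectral_norm n (M' \<omega>) \<ge> \<tau>}
      \<le> 1 / c * measure W {\<omega> \<in> space W.
          spectral_norm (n div 2) (top_right_corner n (permute_matrix n (\<sigma> \<omega>) (M' \<omega>))) \<ge> c * \<tau>
            \<and> \<omega> \<in> space W}"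
    using assms(3,4) W.prob_space_axioms M' zero unif indep cond \<tau>
    unfolding property_P_def random_matrix_def by blast
  also have "{\<omega> \<in> space W.
          spectral_norm (n div 2) (top_right_corner n (permute_matrix n (\<sigma> \<omega>) (M' \<omega>))) \<ge> c * \<tau>
            \<and> \<omega> \<in> space W} = (\<lambda>\<omega>. permute_matrix n (\<sigma> \<omega>) (M' \<omega>)) -` Good \<inter> space W"
    (is "_ = ?G") using measurable_space[OF \<sigma>M'] by (auto simp: Good_def)
  also have "{\<omega> \<in> space W. spectral_norm n (M' \<omega>) \<ge> \<tau>} = M' -` Bad \<inter> space W"
    using measurable_space[OF M'] by (auto simp: Bad_def)
  also have "measure W (M' -` Bad \<inter> space W) = measure \<Omega> {\<omega> \<in> space \<Omega>. spectral_norm n (M \<omega>) \<ge> \<tau>}"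
  proof -
    have sub: "clear_diagonal n -` Bad \<inter> space L \<in> sets L"
      using meas_L Bad by (rule measurable_sets)
    have "measure W (M' -` Bad \<inter> space W)
        = measure (distr W L fst) (clear_diagonal n -` Bad \<inter> space L)"
      using sub unfolding W_def
      by (subst measure_distr) (auto simp: M'_def space_pair_measure intro!: arg_cong2[where f = measure])
    also have "\<dots> = measure L (clear_diagonal n -` Bad \<inter> space L)"
      unfolding W_def by (simp only: V.distr_pair_fst)
    also have "\<dots> = measure \<Omega> (M -` (clear_diagonal n -` Bad \<inter> space L) \<inter> space \<Omega>)"
      using sub M by (simp add: L_def measure_distr)
    also have "M -` (clear_diagonal n -` Bad \<inter> space L) \<inter> space \<Omega>
        = {\<omega> \<in> space \<Omega>. spectral_norm n (M \<omega>) \<ge> \<tau>}"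
      using measurable_space[OF M] by (auto simp: diag Bad_def spaceL)
    finally show ?thesis .
  qed
  also have "measure W ?G = measure \<Omega> {\<omega> \<in> space \<Omega>. M \<omega> \<in> Good}"
  proof -
    have G: "?G \<in> sets (L \<Otimes>\<^sub>M V)"
      using measurable_sets[OF \<sigma>M' Good] by (simp add: W_def)
    \<comment> \<open>Conditionally on the permutation, the permuted matrix has the law of \<open>M\<close>.\<close>
    have "emeasure W ?G = (\<integral>\<^sup>+ v. emeasure L ((\<lambda>A. (A, v)) -` ?G) \<partial>V)"
      unfolding W_def by (rule LV.emeasure_pair_measure_alt2) (use G in \<open>simp add: W_def\<close>)
    also have "\<dots> = (\<integral>\<^sup>+ v. emeasure \<Omega> {\<omega> \<in> space \<Omega>. M \<omega> \<in> Good} \<partial>V)"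
    proof (rule nn_integral_cong)
      fix v assume v: "v \<in> space V"
      hence \<pi>: "fst v permutes {1..n}"
        using measurable_space[OF meas_fst] by (auto simp: perms_def)
      have "emeasure L ((\<lambda>A. (A, v)) -` ?G) = emeasure \<Omega> (M -` ((\<lambda>A. (A, v)) -` ?G) \<inter> space \<Omega>)"
        unfolding L_def using M sets_Pair2[OF G, of v] setsL by (intro emeasure_distr) auto
      also have "M -` ((\<lambda>A. (A, v)) -` ?G) \<inter> space \<Omega>
          = {\<omega> \<in> space \<Omega>. permute_matrix n (fst v) (M \<omega>) \<in> Good}"
        using v measurable_space[OF M]
        by (auto simp: \<sigma>_def M'_def W_def space_pair_measure spaceL diag)
      also have "emeasure \<Omega> \<dots> = emeasure \<Omega> {\<omega> \<in> space \<Omega>. M \<omega> \<in> Good}"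
        by (rule jointly_exchangeable_emeasure_eq[OF assms(6) \<pi> Good])
      finally show "emeasure L ((\<lambda>A. (A, v)) -` ?G) = emeasure \<Omega> {\<omega> \<in> space \<Omega>. M \<omega> \<in> Good}" .
    qed
    also have "\<dots> = emeasure \<Omega> {\<omega> \<in> space \<Omega>. M \<omega> \<in> Good}"
      by (simp add: V.emeasure_space_1)
    finally show ?thesis by (simp add: measure_def)
  qed
  also have "{\<omega> \<in> space \<Omega>. M \<omega> \<in> Good}
      = {\<omega> \<in> space \<Omega>. spectral_norm (n div 2) (top_right_corner n (M \<omega>)) \<ge> c * \<tau>}"
    using measurable_space[OF M] by (auto simp: Good_def)
  finally show "measure \<Omega> {\<omega> \<in> space \<Omega>. spectral_norm n (M \<omega>) \<ge> \<tau>}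
    \<le> 1 / c * measure \<Omega> {\<omega> \<in> space \<Omega>.
        spectral_norm (n div 2) (top_right_corner n (M \<omega>)) \<ge> c * \<tau>}" .
qed

end
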